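(* The transactional x86 and C++ memory models enjoy transactional monotonicity for all executions with up to 6 events: adding $\mathit{stxn}$ edges never makes an inconsistent execution consistent. That is, for each of the two models $M$ (transactional x86; transactional C++), if $X$ and $Y$ are well-formed executions of $M$ with $|E|\le 6$ that are identical except that $\mathit{stxn}_X\subseteq\mathit{stxn}_Y$, and $X$ is inconsistent under $M$, then $Y$ is inconsistent under $M$.
   Context: **Notation.** For binary relations on a set of events $E$: $r^{-1}$, $r^?$, $r^+$, $r^*$ are inverse, reflexive closure, transitive closure, reflexive-transitive closure; $\neg$ is complement; $r_1;r_2$ is relational composition (left to right); $[s]=\{(x,x)\mid x\in s\}$; $r$ is acyclic iff $r^+$ is irreflexive. $r_{\rm e}=r\setminus(\mathit{po}\cup\mathit{po}^{-1})^*$, $r_{\rm loc}=r\cap\mathit{sloc}$, $r_{\neq\rm loc}=r\setminus\mathit{sloc}$. $\mathsf{weaklift}(r,t)=t;(r\setminus t);t$ and $\mathsf{stronglift}(r,t)=t^?;(r\setminus t);t^?$. **Executions.** An execution is a finite set $E$ of events, partitioned into reads $R$, writes $W$, fences $F$, with relations satisfying: $\mathit{po}$ is, for each thread, a strict total order on that thread's events (relating only events of the same thread); dependencies $\mathit{addr},\mathit{ctrl},\mathit{data}\subseteq\mathit{po}$ originate at reads; $\mathit{sloc}$ is an equivalence relation on $R\cup W$ (same location); $\mathit{rmw}\subseteq\mathit{po}_{\rm loc}$ links the read of a read-modify-write to its write; $\mathit{rf}$ goes from writes to reads of the same location, each read having at most one incoming edge; $\mathit{co}$ relates writes to the same location and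 is, per location, a strict total order; $\mathit{stxn}$ (same successful transaction) is a partial equivalence relation whose classes are contiguous subsets of $\mathit{po}$ (of one thread). $\mathit{fr}=([R];\mathit{sloc};[W])\setminus(\mathit{rf}^{-1};(\mathit{co}^{-1})^* )$, $\mathit{com}=\mathit{rf}\cup\mathit{co}\cup\mathit{fr}$. **Transactional x86.** $\mathit{mfence}$ relates events in program order separated by an MFENCE fence event. Let - $\mathit{ppo}=((W\times W)\cup(R\times W)\cup(R\times R))\cap\mathit{po}$ - $\mathit{tfence}=\mathit{po}\cap((\neg\mathit{stxn};\mathit{stxn})\cup(\mathit{stxn};\neg\mathit{stxn}))$ - $L=\mathrm{domain}(\mathit{rmw})\cup\mathrm{range}(\mathit{rmw})$, $\ \mathit{implied}=([L];\mathit{po})\cup(\mathit{po};[L])\cup\mathit{tfence}$ - $\mathit{hb}=\mathit{mfence}\cup\mathit{ppo}\cup\mathit{implied}\cup\mathit{rf}_{\rm e}\cup\mathit{fr}\cup\mathit{co}$ Consistent iff: $\mathit{po}_{\rm loc}\cup\mathit{com}$ acyclic; $\mathit{rmw}\cap(\mathit{fr}_{\rm e};\mathit{co}_{\rm e})=\emptyset$; $\mathit{hb}$ acyclic; $\mathsf{stronglift}(\mathit{com},\mathit{stxn})$ acyclic; $\mathsf{stronglift}(\mathit{hb},\mathit{stxn})$ acyclic. **Transactional C++.** Executions have in addition sets $\mathit{Ato}$ (events of atomic operations) and $\mathit{Acq},\mathit{Rel},\mathit{SC}\subseteq\mathit{Ato}$, with $R\cap\mathit{SC}\subseteq\mathit{Acq}$,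 $W\cap\mathit{SC}\subseteq\mathit{Rel}$, $F\cap\mathit{SC}\subseteq\mathit{Acq}\cap\mathit{Rel}$, and both ends of $\mathit{rmw}$ edges in $\mathit{Ato}$. Let - $\mathit{sw}=[\mathit{Rel}];([F];\mathit{po})^?;[W];\mathit{po}_{\rm loc}^*;[W\cap\mathit{Ato}];(\mathit{rf};\mathit{rmw})^*;\mathit{rf};[R\cap\mathit{Ato}];(\mathit{po};[F])^?;[\mathit{Acq}]$ - $\mathit{ecom}=\mathit{com}\cup(\mathit{co};\mathit{rf})$, $\ \mathit{tsw}=\mathsf{weaklift}(\mathit{ecom},\mathit{stxn})$, $\ \mathit{hb}=(\mathit{sw}\cup\mathit{tsw}\cup\mathit{po})^+$ - $\mathit{scb}=\mathit{po}\cup(\mathit{po}_{\neq\rm loc};\mathit{hb};\mathit{po}_{\neq\rm loc})\cup\mathit{hb}_{\rm loc}\cup\mathit{co}\cup\mathit{fr}$ - $\mathit{psc}=\big(([\mathit{SC}]\cup[F\cap\mathit{SC}];\mathit{hb}^?);\mathit{scb};([\mathit{SC}]\cup\mathit{hb}^?;[F\cap\mathit{SC}])\big)\cup\big([F\cap\mathit{SC}];(\mathit{hb}\cup\mathit{hb};\mathit{com}^+;\mathit{hb});[F\cap\mathit{SC}]\big)$ Consistent iff: $\mathit{hb};\mathit{com}^*$ irreflexive; $\mathit{rmw}\cap(\mathit{fr}_{\rm e};\mathit{co}_{\rm e})=\emptyset$; $\mathit{po}\cup\mathit{rf}$ acyclic; $\mathit{psc}$ acyclic. *)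

theory Defs
  imports Main
begin

text \<open>
  Relations on the events of an execution are library relations over the type of events.
  Complement, reflexive closure and reflexive-transitive closure are therefore taken over the
  whole type rather than over the finite set of events. This makes no difference below, because
  each of them is only ever composed or intersected with, or subtracted from, a relation between
  events of the execution.
\<close>

section \<open>Executions\<close>

text \<open>
  The relation \<open>sthd\<close> (same thread) makes the division of the events into threads explicit.
  In a well-formed execution it is determined by \<open>po\<close>: distinct events are related by \<open>sthd\<close>
  iff they are ordered by \<open>po\<close> one way or the other.
\<close>

record 'e exec =
  events :: "'e set"
  reads :: "'e set"
  writes :: "'e set"
  fences :: "'e set"
  sthd :: "'e rel"
  po :: "'e rel"
  addr :: "'e rel"
  ctrl :: "'e rel"
  data :: "'e rel"
  sloc :: "'e rel"
  rmw :: "'e rel"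
  rf :: "'e rel"
  co :: "'e rel"
  stxn :: "'e rel"

definition external :: "('e, 'x) exec_scheme \<Rightarrow> 'e rel \<Rightarrow> 'e rel" where
  "external X r = r - (po X \<union> (po X)\<inverse>)\<^sup>*"

definition same_loc :: "('e, 'x) exec_scheme \<Rightarrow> 'e rel \<Rightarrow> 'e rel" where
  "same_loc X r = r \<inter> sloc X"

definition diff_loc :: "('e, 'x) exec_scheme \<Rightarrow> 'e rel \<Rightarrow> 'e rel" where
  "diff_loc X r = r - sloc X"

definition weaklift :: "'e rel \<Rightarrow> 'e rel \<Rightarrow> 'e rel" where
  "weaklift r t = t O (r - t) O t"

definition stronglift :: "'e rel \<Rightarrow> 'e rel \<Rightarrow> 'e rel" where
  "stronglift r t = t\<^sup>= O (r - t) O t\<^sup>="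

definition fr :: "('e, 'x) exec_scheme \<Rightarrow> 'e rel" where
  "fr X = (Id_on (reads X) O sloc X O Id_on (writes X)) - ((rf X)\<inverse> O ((co X)\<inverse>)\<^sup>*)"

definition com :: "('e, 'x) exec_scheme \<Rightarrow> 'e rel" where
  "com X = rf X \<union> co X \<union> fr X"

definition wf_exec :: "('e, 'x) exec_scheme \<Rightarrow> bool" where
  "wf_exec X \<longleftrightarrow>
     finite (events X) \<and>
     events X = reads X \<union> writes X \<union> fences X \<and>
     reads X \<inter> writes X = {} \<and> reads X \<inter> fences X = {} \<and> writes X \<inter> fences X = {} \<and>
     equiv (events X) (sthd X) \<and>
     po X \<subseteq> sthd X \<and> irrefl (po X) \<and> trans (po X) \<and>
     (\<forall>a b. (a, b) \<in> sthd X \<and> a \<noteq> b \<longrightarrow> (a, b) \<in> po X \<or> (b, a) \<in> po X) \<and>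
     addr X \<subseteq> po X \<and> ctrl X \<subseteq> po X \<and> data X \<subseteq> po X \<and>
     Domain (addr X) \<subseteq> reads X \<and> Domain (ctrl X) \<subseteq> reads X \<and> Domain (data X) \<subseteq> reads X \<and>
     equiv (reads X \<union> writes X) (sloc X) \<and>
     rmw X \<subseteq> same_loc X (po X) \<inter> (reads X \<times> writes X) \<and>
     rf X \<subseteq> (writes X \<times> reads X) \<inter> sloc X \<and>
     single_valued ((rf X)\<inverse>) \<and>
     co X \<subseteq> (writes X \<times> writes X) \<inter> sloc X \<and> irrefl (co X) \<and> trans (co X) \<and>
     (\<forall>a\<in>writes X. \<forall>b\<in>writes X.
        (a, b) \<in> sloc X \<and> a \<noteq> b \<longrightarrow> (a, b) \<in> co X \<or> (b, a) \<in> co X) \<and>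
     sym (stxn X) \<and> trans (stxn X) \<and> stxn X \<subseteq> sthd X \<and>
     (\<forall>a b c. (a, b) \<in> po X \<and> (b, c) \<in> po X \<and> (a, c) \<in> stxn X \<longrightarrow> (a, b) \<in> stxn X)"

definition rmw_isolated :: "('e, 'x) exec_scheme \<Rightarrow> bool" where
  "rmw_isolated X \<longleftrightarrow> rmw X \<inter> (external X (fr X) O external X (co X)) = {}"


section \<open>Transactional x86\<close>

record 'e x86_exec = "'e exec" +
  MFENCE :: "'e set"

definition x86_wf :: "'e x86_exec \<Rightarrow> bool" where
  "x86_wf X \<longleftrightarrow> wf_exec X \<and> MFENCE X \<subseteq> fences X"

definition mfence :: "'e x86_exec \<Rightarrow> 'e rel" where
  "mfence X = po X O Id_on (MFENCE X) O po X"

definition ppo :: "'e x86_exec \<Rightarrow> 'e rel" where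
  "ppo X = ((writes X \<times> writes X) \<union> (reads X \<times> writes X) \<union> (reads X \<times> reads X)) \<inter> po X"

definition tfence :: "'e x86_exec \<Rightarrow> 'e rel" where
  "tfence X = po X \<inter> ((- stxn X O stxn X) \<union> (stxn X O - stxn X))"

definition locked :: "'e x86_exec \<Rightarrow> 'e set" where
  "locked X = Domain (rmw X) \<union> Range (rmw X)"

definition implied :: "'e x86_exec \<Rightarrow> 'e rel" where
  "implied X = (Id_on (locked X) O po X) \<union> (po X O Id_on (locked X)) \<union> tfence X"

definition x86_hb :: "'e x86_exec \<Rightarrow> 'e rel" where
  "x86_hb X = mfence X \<union> ppo X \<union> implied X \<union> external X (rf X) \<union> fr X \<union> co X"

definition x86_consistent :: "'e x86_exec \<Rightarrow> bool" where
  "x86_consistent X \<longleftrightarrow>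
     acyclic (same_loc X (po X) \<union> com X) \<and>
     rmw_isolated X \<and>
     acyclic (x86_hb X) \<and>
     acyclic (stronglift (com X) (stxn X)) \<and>
     acyclic (stronglift (x86_hb X) (stxn X))"


section \<open>Transactional C++\<close>

record 'e cpp_exec = "'e exec" +
  Ato :: "'e set"
  Acq :: "'e set"
  Rel :: "'e set"
  SC :: "'e set"

definition cpp_wf :: "'e cpp_exec \<Rightarrow> bool" where
  "cpp_wf X \<longleftrightarrow>
     wf_exec X \<and>
     Ato X \<subseteq> events X \<and> Acq X \<subseteq> Ato X \<and> Rel X \<subseteq> Ato X \<and> SC X \<subseteq> Ato X \<and>
     reads X \<inter> SC X \<subseteq> Acq X \<and>
     writes X \<inter> SC X \<subseteq> Rel X \<and>
     fences X \<inter> SC X \<subseteq> Acq X \<inter> Rel X \<and>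
     Domain (rmw X) \<union> Range (rmw X) \<subseteq> Ato X"

definition sw :: "'e cpp_exec \<Rightarrow> 'e rel" where
  "sw X =
     Id_on (Rel X) O (Id_on (fences X) O po X)\<^sup>= O Id_on (writes X) O
     (same_loc X (po X))\<^sup>* O Id_on (writes X \<inter> Ato X) O (rf X O rmw X)\<^sup>* O
     rf X O Id_on (reads X \<inter> Ato X) O (po X O Id_on (fences X))\<^sup>= O Id_on (Acq X)"

definition ecom :: "'e cpp_exec \<Rightarrow> 'e rel" where
  "ecom X = com X \<union> (co X O rf X)"

definition tsw :: "'e cpp_exec \<Rightarrow> 'e rel" where
  "tsw X = weaklift (ecom X) (stxn X)"

definition cpp_hb :: "'e cpp_exec \<Rightarrow> 'e rel" where
  "cpp_hb X = (sw X \<union> tsw X \<union> po X)\<^sup>+"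

definition scb :: "'e cpp_exec \<Rightarrow> 'e rel" where
  "scb X =
     po X \<union> (diff_loc X (po X) O cpp_hb X O diff_loc X (po X)) \<union>
     same_loc X (cpp_hb X) \<union> co X \<union> fr X"

definition psc :: "'e cpp_exec \<Rightarrow> 'e rel" where
  "psc X =
     ((Id_on (SC X) \<union> Id_on (fences X \<inter> SC X) O (cpp_hb X)\<^sup>=) O
      scb X O
      (Id_on (SC X) \<union> (cpp_hb X)\<^sup>= O Id_on (fences X \<inter> SC X))) \<union>
     (Id_on (fences X \<inter> SC X) O
      (cpp_hb X \<union> cpp_hb X O (com X)\<^sup>+ O cpp_hb X) O
      Id_on (fences X \<inter> SC X))"

definition cpp_consistent :: "'e cpp_exec \<Rightarrow> bool" where
  "cpp_consistent X \<longleftrightarrow>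
     irrefl (cpp_hb X O (com X)\<^sup>*) \<and>
     rmw_isolated X \<and>
     acyclic (po X \<union> rf X) \<and>
     acyclic (psc X)"


section \<open>Transactional monotonicity\<close>

text \<open>
  A memory model is given by its well-formedness and its consistency predicate. The equation
  \<open>Y = X\<lparr>stxn := stxn Y\<rparr>\<close> says that \<open>X\<close> and \<open>Y\<close> agree on every other component, including
  those specific to the model.
\<close>

definition txn_monotone_upto ::
    "nat \<Rightarrow> (('e, 'x) exec_scheme \<Rightarrow> bool) \<Rightarrow> (('e, 'x) exec_scheme \<Rightarrow> bool) \<Rightarrow> bool" where
  "txn_monotone_upto n well_formed consistent \<longleftrightarrow>
     (\<forall>X Y. well_formed X \<and> well_formed Y \<and> card (events X) \<le> n \<and>
            Y = X\<lparr>stxn := stxn Y\<rparr> \<and> stxn X \<subseteq> stxn Y \<and>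
            \<not> consistent X \<longrightarrow> \<not> consistent Y)"

end

(* Whatever is lost when transactions grow from X to Y is an edge between two transactions of X (or
   at the boundary of one) whose ends lie in a single transaction of Y, hence in a single thread.
   Coherence forces such an edge to agree with po, and since the transactions of X are contiguous,
   so does its lifting along stxn X. In C++, po is part of hb, so hb only grows. In x86, a cycle of
   lifted edges of X either stays inside one transaction of Y, where it would be a cycle in po, or
   its edges that leave a transaction of Y, with the remaining ones absorbed into the lifting, form
   a cycle of lifted edges of Y. *)

theory Submission
  imports Defs
begin

section \<open>Acyclicity of unions and of lifted relations\<close>

lemma stronglift_empty [simp]: "stronglift r {} = r"
  by (simp add: stronglift_def)

text \<open>A \<open>q\<close> step next to an \<open>s\<close> step merges into it, so a path with
  at least one \<open>s\<close> step collapses to \<open>s\<close> steps only.\<close>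

lemma trancl_Un_absorb:
  assumes "q O s \<subseteq> s" and "s O q \<subseteq> s"
  shows "(s \<union> q)\<^sup>+ \<subseteq> s\<^sup>+ \<union> q\<^sup>+"
proof (rule subrelI)
  fix x y assume "(x, y) \<in> (s \<union> q)\<^sup>+"
  then show "(x, y) \<in> s\<^sup>+ \<union> q\<^sup>+"
  proof induction
    case (base y)
    then show ?case by auto
  next
    case (step y z)
    have q_s: "(a, c) \<in> s" if "(a, b) \<in> q\<^sup>+" "(b, c) \<in> s" for a b c
      using that by (induction rule: trancl_induct) (use assms(1) in blast)+
    have s_q: "(a, c) \<in> s\<^sup>+" if "(a, b) \<in> s\<^sup>+" "(b, c) \<in> q" for a b c
      using that(1)
    proof (cases rule: tranclE)
      case base
      then show ?thesis using that(2) assms(2) by blast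
    next
      case (step d)
      then show ?thesis using that(2) assms(2) by (meson relcompI subsetD trancl_into_trancl)
    qed
    from step show ?case
      by (auto intro: trancl_into_trancl s_q dest: q_s)
  qed
qed

lemma acyclic_Un_absorb:
  assumes "acyclic s" "acyclic q" "q O s \<subseteq> s" "s O q \<subseteq> s"
  shows "acyclic (s \<union> q)"
  using assms(1,2) trancl_Un_absorb[OF assms(3,4)] unfolding acyclic_def by blast

text \<open>If its core \<open>r\<close> edge leaves \<open>t'\<close>, an edge of the finer lift is
  an edge of \<open>stronglift r' t'\<close>; otherwise it lies wholly in \<open>t'\<close>, hence
  in \<open>p\<close>. The intended \<open>p\<close> is \<open>po\<close>, the intended
  \<open>t\<close> is \<open>stxn X\<close> or \<open>{}\<close>.\<close>

lemma acyclic_stronglift_coarsen: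
  assumes "trans t'" and "t \<subseteq> t'" and "r \<subseteq> r' \<union> t'"
    and "stronglift r t \<inter> t' \<subseteq> p" and "acyclic p"
    and "acyclic (stronglift r' t')"
  shows "acyclic (stronglift r t)"
proof (rule acyclic_subset)
  show "stronglift r t \<subseteq> stronglift r' t' \<union> (p \<inter> t')"
  proof (rule subrelI)
    fix x y assume xy: "(x, y) \<in> stronglift r t"
    then obtain b c where b: "(x, b) \<in> t\<^sup>=" and bc: "(b, c) \<in> r" and c: "(c, y) \<in> t\<^sup>="
      unfolding stronglift_def by blast
    show "(x, y) \<in> stronglift r' t' \<union> (p \<inter> t')"
    proof (cases "(b, c) \<in> t'")
      case True
      then have "(x, y) \<in> t'"
        using b c \<open>t \<subseteq> t'\<close> \<open>trans t'\<close> by (auto dest: transD)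
      then show ?thesis using xy assms(4) by blast
    next
      case False
      then show ?thesis
        using b bc c assms(2,3) unfolding stronglift_def by blast
    qed
  qed
  \<comment> \<open>The \<open>t'\<^sup>=\<close> ends of a lifted edge swallow adjacent steps in
    \<open>p \<inter> t'\<close>.\<close>
  have "t' O t'\<^sup>= \<subseteq> t'\<^sup>=" "t'\<^sup>= O t' \<subseteq> t'\<^sup>="
    using \<open>trans t'\<close> by (auto dest: transD)
  then have "(p \<inter> t') O stronglift r' t' \<subseteq> stronglift r' t'"
      "stronglift r' t' O (p \<inter> t') \<subseteq> stronglift r' t'"
    unfolding stronglift_def by blast+
  moreover have "acyclic (p \<inter> t')"
    using \<open>acyclic p\<close> by (rule acyclic_subset) blast
  ultimately show "acyclic (stronglift r' t' \<union> (p \<inter> t'))"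
    using assms(6) by (intro acyclic_Un_absorb)
qed

section \<open>Program order, transactions and coherence in one execution\<close>

context
  fixes X :: "('e, 'x) exec_scheme"
  assumes wf: "wf_exec X"
begin

lemma acyclic_po: "acyclic (po X)"
  using wf by (simp add: wf_exec_def acyclic_irrefl)

lemma sym_sthd: "sym (sthd X)" and trans_sthd: "trans (sthd X)"
  using wf by (auto simp: wf_exec_def equiv_def)

lemma sym_stxn: "sym (stxn X)" and trans_stxn: "trans (stxn X)"
  and stxn_subset_sthd: "stxn X \<subseteq> sthd X"
  using wf by (auto simp: wf_exec_def)

lemma po_total: "(a, b) \<in> sthd X \<Longrightarrow> a \<noteq> b \<Longrightarrow> (a, b) \<in> po X \<or> (b, a) \<in> po X"
  using wf by (simp add: wf_exec_def)

lemma stxn_contiguous: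
  "(a, b) \<in> po X \<Longrightarrow> (b, c) \<in> po X \<Longrightarrow> (a, c) \<in> stxn X \<Longrightarrow> (a, b) \<in> stxn X"
  using wf unfolding wf_exec_def by blast

text \<open>If \<open>c\<close> came before \<open>a\<close>, it would lie between two events of one
  transaction, and contiguity would put it inside.\<close>

lemma po_stxn_left:
  assumes "(a, b) \<in> (stxn X)\<^sup>=" "(b, c) \<in> po X - stxn X"
  shows "(a, c) \<in> po X - stxn X"
proof (cases "a = b")
  case False
  then have ab: "(a, b) \<in> stxn X" "(b, a) \<in> stxn X"
    using assms(1) sym_stxn by (auto dest: symD)
  then have "(a, c) \<notin> stxn X" "a \<noteq> c"
    using assms(2) trans_stxn by (auto dest: transD)
  moreover have "(b, c) \<in> sthd X"
    using assms(2) wf by (auto simp: wf_exec_def)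
  then have "(a, c) \<in> sthd X"
    using ab(1) stxn_subset_sthd trans_sthd by (auto dest: transD)
  moreover have "(c, a) \<notin> po X"
    using stxn_contiguous[of b c a] assms(2) ab by auto
  ultimately show ?thesis using po_total by blast
qed (use assms in auto)

lemma po_stxn_right:
  assumes "(a, b) \<in> po X - stxn X" "(b, c) \<in> (stxn X)\<^sup>="
  shows "(a, c) \<in> po X - stxn X"
proof (cases "b = c")
  case False
  then have bc: "(b, c) \<in> stxn X" "(c, b) \<in> stxn X"
    using assms(2) sym_stxn by (auto dest: symD)
  then have ac: "(a, c) \<notin> stxn X" "a \<noteq> c"
    using assms(1) trans_stxn by (auto dest: transD)
  moreover have "(a, b) \<in> sthd X"
    using assms(1) wf by (auto simp: wf_exec_def)
  then have "(a, c) \<in> sthd X"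
    using bc(1) stxn_subset_sthd trans_sthd by (auto dest: transD)
  moreover have "(c, a) \<notin> po X"
    using stxn_contiguous[of c a b] assms(1) bc ac sym_stxn by (auto dest: symD)
  ultimately show ?thesis using po_total by blast
qed (use assms in auto)

text \<open>The ends of a lift move only within a thread, so the core edge lies in that thread too.
  There it follows \<open>po\<close>, and contiguity carries its direction over to the lifted
  edge.\<close>

lemma stronglift_stxn_Int_sthd:
  assumes "r \<inter> sthd X \<subseteq> po X"
  shows "stronglift r (stxn X) \<inter> sthd X \<subseteq> po X"
proof (rule subrelI)
  fix x y assume "(x, y) \<in> stronglift r (stxn X) \<inter> sthd X"
  then obtain b c where xb: "(x, b) \<in> (stxn X)\<^sup>=" and bc: "(b, c) \<in> r - stxn X"
    and cy: "(c, y) \<in> (stxn X)\<^sup>=" and xy: "(x, y) \<in> sthd X"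
    unfolding stronglift_def by blast
  have "b = x \<or> (b, x) \<in> sthd X" "y = c \<or> (y, c) \<in> sthd X"
    using xb cy stxn_subset_sthd sym_sthd by (auto dest: symD)
  then have "(b, c) \<in> sthd X"
    using xy trans_sthd by (blast dest: transD)
  then have "(b, c) \<in> po X - stxn X"
    using bc assms by blast
  then show "(x, y) \<in> po X"
    using po_stxn_left[OF xb] po_stxn_right[OF _ cy] by blast
qed

lemma com_subset_sloc: "com X \<subseteq> sloc X"
  using wf by (auto simp: com_def fr_def wf_exec_def)

lemma irrefl_com: "(a, a) \<notin> com X"
  using wf by (auto simp: com_def fr_def wf_exec_def irrefl_def)

text \<open>A \<open>com\<close> edge against \<open>po\<close> would close a two-step cycle with
  same-location \<open>po\<close>.\<close>

lemma com_Int_sthd: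
  assumes "acyclic (same_loc X (po X) \<union> com X)"
  shows "com X \<inter> sthd X \<subseteq> po X"
proof (rule subrelI)
  fix a b assume ab: "(a, b) \<in> com X \<inter> sthd X"
  have "(b, a) \<notin> po X"
  proof
    assume "(b, a) \<in> po X"
    moreover have "(b, a) \<in> sloc X"
      using ab com_subset_sloc wf by (auto simp: wf_exec_def equiv_def dest: symD)
    ultimately have "(b, b) \<in> (same_loc X (po X) \<union> com X)\<^sup>+"
      using ab by (auto simp: same_loc_def intro: trancl_trans)
    then show False using assms by (simp add: acyclic_def)
  qed
  then show "(a, b) \<in> po X"
    using ab irrefl_com po_total by blast
qed

end

section \<open>Notions that do not depend on \<open>stxn\<close>\<close>

lemma fr_stxn_update [simp]: "fr (X\<lparr>stxn := t\<rparr>) = fr X"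
  by (simp add: fr_def)

lemma com_stxn_update [simp]: "com (X\<lparr>stxn := t\<rparr>) = com X"
  by (simp add: com_def)

lemma same_loc_stxn_update [simp]: "same_loc (X\<lparr>stxn := t\<rparr>) r = same_loc X r"
  by (simp add: same_loc_def)

lemma diff_loc_stxn_update [simp]: "diff_loc (X\<lparr>stxn := t\<rparr>) r = diff_loc X r"
  by (simp add: diff_loc_def)

lemma external_stxn_update [simp]: "external (X\<lparr>stxn := t\<rparr>) r = external X r"
  by (simp add: external_def)

lemma rmw_isolated_stxn_update [simp]: "rmw_isolated (X\<lparr>stxn := t\<rparr>) = rmw_isolated X"
  by (simp add: rmw_isolated_def)

lemma sw_stxn_update [simp]: "sw (X\<lparr>stxn := t\<rparr>) = sw X"
  by (simp add: sw_def)

lemma ecom_stxn_update [simp]: "ecom (X\<lparr>stxn := t\<rparr>) = ecom X"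
  by (simp add: ecom_def)

section \<open>Transactional x86\<close>

lemma x86_hb_Int_sthd:
  assumes "wf_exec X" and "acyclic (same_loc X (po X) \<union> com X)"
  shows "x86_hb X \<inter> sthd X \<subseteq> po X"
proof -
  have "trans (po X)"
    using assms(1) by (simp add: wf_exec_def)
  then have "mfence X \<subseteq> po X"
    by (auto simp: mfence_def dest: transD)
  moreover have "ppo X \<union> implied X \<subseteq> po X"
    by (auto simp: ppo_def implied_def tfence_def)
  moreover have "external X (rf X) \<union> fr X \<union> co X \<subseteq> com X"
    by (auto simp: external_def com_def)
  ultimately have "x86_hb X \<subseteq> po X \<union> com X"
    by (auto simp: x86_hb_def)
  then show ?thesis
    using com_Int_sthd[OF assms] by blast
qed

text \<open>A boundary edge can be lost only by falling inside a transaction of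
  \<open>t\<close>.\<close>

lemma tfence_stxn_mono:
  assumes "trans t" "stxn X \<subseteq> t"
  shows "tfence X \<subseteq> tfence (X\<lparr>stxn := t\<rparr>) \<union> t"
proof (rule subrelI)
  fix a b assume ab: "(a, b) \<in> tfence X"
  show "(a, b) \<in> tfence (X\<lparr>stxn := t\<rparr>) \<union> t"
  proof (cases "(a, b) \<in> t")
    case False
    \<comment> \<open>Only the positive half of each disjunct survives enlarging
      \<open>stxn X\<close> to \<open>t\<close>; the negative half is recovered from
      \<open>(a, b) \<notin> t\<close> by transitivity.\<close>
    from ab have po: "(a, b) \<in> po X"
      and "(\<exists>c. (c, b) \<in> stxn X) \<or> (\<exists>c. (a, c) \<in> stxn X)"
      by (auto simp: tfence_def)
    then consider c where "(c, b) \<in> t" | c where "(a, c) \<in> t"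
      using assms(2) by blast
    then have "(a, b) \<in> (- t O t) \<union> (t O - t)"
    proof cases
      case 1
      then have "(a, c) \<notin> t" using False assms(1) by (auto dest: transD)
      with 1 show ?thesis by blast
    next
      case 2
      then have "(c, b) \<notin> t" using False assms(1) by (auto dest: transD)
      with 2 show ?thesis by blast
    qed
    then show ?thesis using po by (simp add: tfence_def)
  qed simp
qed

lemma x86_hb_stxn_mono:
  assumes "trans t" "stxn X \<subseteq> t"
  shows "x86_hb X \<subseteq> x86_hb (X\<lparr>stxn := t\<rparr>) \<union> t"
proof -
  have "mfence (X\<lparr>stxn := t\<rparr>) = mfence X" "ppo (X\<lparr>stxn := t\<rparr>) = ppo X"
    "locked (X\<lparr>stxn := t\<rparr>) = locked X"
    by (simp_all add: mfence_def ppo_def locked_def)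
  then show ?thesis
    using tfence_stxn_mono[OF assms] by (simp add: x86_hb_def implied_def) blast
qed

text \<open>Coherence and atomicity do not mention \<open>stxn\<close>; the other three axioms
  reduce to lifted acyclicity over \<open>t\<close>.\<close>

lemma x86_consistent_antimono:
  assumes wfX: "wf_exec X" and wfY: "wf_exec (X\<lparr>stxn := t\<rparr>)" and sub: "stxn X \<subseteq> t"
    and cons: "x86_consistent (X\<lparr>stxn := t\<rparr>)"
  shows "x86_consistent X"
proof -
  have t: "trans t" "t \<subseteq> sthd X"
    using wfY by (auto simp: wf_exec_def)
  have coh: "acyclic (same_loc X (po X) \<union> com X)"
    and iso: "rmw_isolated X"
    and txn: "acyclic (stronglift (com X) t)"
    and hb_txn: "acyclic (stronglift (x86_hb (X\<lparr>stxn := t\<rparr>)) t)"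
    using cons by (simp_all add: x86_consistent_def)
  note com_po = com_Int_sthd[OF wfX coh] and hb_po = x86_hb_Int_sthd[OF wfX coh]
  note hb_sub = x86_hb_stxn_mono[OF t(1) sub]
  have "acyclic (stronglift (com X) (stxn X))"
    by (rule acyclic_stronglift_coarsen[OF t(1) sub _ _ acyclic_po[OF wfX] txn])
      (use stronglift_stxn_Int_sthd[OF wfX com_po] t(2) in blast)+
  moreover have "acyclic (stronglift (x86_hb X) (stxn X))"
    by (rule acyclic_stronglift_coarsen[OF t(1) sub hb_sub _ acyclic_po[OF wfX] hb_txn])
      (use stronglift_stxn_Int_sthd[OF wfX hb_po] t(2) in blast)
  \<comment> \<open>Plain acyclicity is the case of no transactions. It is drawn from the lifted
    axiom because \<open>tfence\<close> edges inside \<open>t\<close> may be missing from the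
    updated \<open>x86_hb\<close>; lifting absorbs them.\<close>
  moreover have "acyclic (stronglift (x86_hb X) {})"
    by (rule acyclic_stronglift_coarsen[OF t(1) _ hb_sub _ acyclic_po[OF wfX] hb_txn])
      (use hb_po t(2) in auto)
  ultimately show ?thesis
    using coh iso by (simp add: x86_consistent_def)
qed

section \<open>Transactional C++\<close>

lemma tsw_stxn_mono:
  assumes wfX: "wf_exec X" and t: "t \<subseteq> sthd X" and sub: "stxn X \<subseteq> t"
    and coh: "irrefl (po X O (com X)\<^sup>*)"
  shows "tsw X \<subseteq> tsw (X\<lparr>stxn := t\<rparr>) \<union> po X"
proof (rule subrelI)
  fix a d assume "(a, d) \<in> tsw X"
  then obtain b c where ab: "(a, b) \<in> stxn X" and bc: "(b, c) \<in> ecom X" "(b, c) \<notin> stxn X"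
    and cd: "(c, d) \<in> stxn X"
    by (auto simp: tsw_def weaklift_def)
  show "(a, d) \<in> tsw (X\<lparr>stxn := t\<rparr>) \<union> po X"
  proof (cases "(b, c) \<in> t")
    case True
    \<comment> \<open>A core edge inside \<open>t\<close> stays in one thread and is to be shown to
      follow \<open>po\<close>. It is no loop, since \<open>b\<close> lies in a transaction of
      \<open>X\<close> and the edge avoids \<open>stxn X\<close>.\<close>
    have "(b, b) \<in> stxn X"
      using ab sym_stxn[OF wfX] trans_stxn[OF wfX] by (blast dest: symD transD)
    then have "b \<noteq> c" using bc by blast
    \<comment> \<open>\<open>co O rf\<close> is two \<open>com\<close> steps, so \<open>coh\<close>
      covers \<open>ecom\<close> as well.\<close>
    moreover have "(b, c) \<in> (com X)\<^sup>*"
      using bc(1) unfolding ecom_def com_def by (blast intro: rtrancl_trans)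
    then have "(c, b) \<notin> po X"
      using coh by (auto simp: irrefl_def)
    ultimately have "(b, c) \<in> po X - stxn X"
      using True t bc(2) po_total[OF wfX] by blast
    then show ?thesis
      using ab cd po_stxn_left[OF wfX, of a b c] po_stxn_right[OF wfX, of a c d] by blast
  next
    case False
    then show ?thesis
      using ab bc cd sub by (auto simp: tsw_def weaklift_def)
  qed
qed

text \<open>\<open>cpp_hb\<close> occurs only positively in \<open>scb\<close> and
  \<open>psc\<close>; their other ingredients do not mention \<open>stxn\<close>.\<close>

lemma psc_mono:
  assumes "cpp_hb X \<subseteq> cpp_hb (X\<lparr>stxn := t\<rparr>)"
  shows "psc X \<subseteq> psc (X\<lparr>stxn := t\<rparr>)"
proof -
  have "scb X \<subseteq> scb (X\<lparr>stxn := t\<rparr>)"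
    using assms unfolding scb_def same_loc_def by simp blast
  moreover have "SC (X\<lparr>stxn := t\<rparr>) = SC X" "fences (X\<lparr>stxn := t\<rparr>) = fences X"
    by simp_all
  ultimately show ?thesis
    using assms unfolding psc_def com_stxn_update
    by (simp only:) (intro Un_mono relcomp_mono order.refl; assumption)
qed

text \<open>Each axiom is independent of \<open>stxn\<close> or forbids something that grows with
  \<open>cpp_hb\<close>, so it suffices to compare \<open>cpp_hb\<close>.\<close>

lemma cpp_consistent_antimono:
  assumes wfX: "wf_exec X" and wfY: "wf_exec (X\<lparr>stxn := t\<rparr>)" and sub: "stxn X \<subseteq> t"
    and cons: "cpp_consistent (X\<lparr>stxn := t\<rparr>)"
  shows "cpp_consistent X"
proof -
  let ?Y = "X\<lparr>stxn := t\<rparr>"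
  have t: "t \<subseteq> sthd X"
    using wfY by (simp add: wf_exec_def)
  have irr: "irrefl (cpp_hb ?Y O (com X)\<^sup>*)" and iso: "rmw_isolated X"
    and porf: "acyclic (po X \<union> rf X)" and psc: "acyclic (psc ?Y)"
    using cons by (simp_all add: cpp_consistent_def)
  \<comment> \<open>The coherence fact needed to compare \<open>tsw\<close> comes from the first
    axiom of \<open>?Y\<close>, restricted to the \<open>po\<close> part of its
    \<open>cpp_hb\<close>.\<close>
  have "po X \<subseteq> cpp_hb ?Y"
    by (auto simp: cpp_hb_def)
  then have "irrefl (po X O (com X)\<^sup>*)"
    using irr unfolding irrefl_def by blast
  then have "tsw X \<subseteq> tsw ?Y \<union> po X"
    by (rule tsw_stxn_mono[OF wfX t sub])
  then have hb: "cpp_hb X \<subseteq> cpp_hb ?Y"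
    unfolding cpp_hb_def by (intro trancl_mono_subset) auto
  then have "irrefl (cpp_hb X O (com X)\<^sup>*)"
    using irr unfolding irrefl_def by blast
  moreover have "acyclic (psc X)"
    using psc psc_mono[OF hb] by (rule acyclic_subset)
  ultimately show ?thesis
    using iso porf by (simp add: cpp_consistent_def)
qed

theorem mainTheorem5:
  shows "txn_monotone_upto 6 (x86_wf :: 'e x86_exec \<Rightarrow> bool) x86_consistent \<and>
         txn_monotone_upto 6 (cpp_wf :: 'e cpp_exec \<Rightarrow> bool) cpp_consistent"
  unfolding txn_monotone_upto_def
proof (intro conjI allI impI; elim conjE)
  fix X Y :: "'e x86_exec"
  assume "x86_wf X" "x86_wf Y" and Y: "Y = X\<lparr>stxn := stxn Y\<rparr>"
    and "stxn X \<subseteq> stxn Y" "\<not> x86_consistent X"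
  then show "\<not> x86_consistent Y"
    using x86_consistent_antimono[of X "stxn Y", folded Y] unfolding x86_wf_def by blast
next
  fix X Y :: "'e cpp_exec"
  assume "cpp_wf X" "cpp_wf Y" and Y: "Y = X\<lparr>stxn := stxn Y\<rparr>"
    and "stxn X \<subseteq> stxn Y" "\<not> cpp_consistent X"
  then show "\<not> cpp_consistent Y"
    using cpp_consistent_antimono[of X "stxn Y", folded Y] unfolding cpp_wf_def by blast
qed

end
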